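(* Let $\mathcal{S}_i\subset\mathscr{L}(X_i)$ be operator semigroups on locally convex spaces $X_i$ for $i=1,2$. (i) Assume that $X_2$ is a subspace of $X_1$ (with the induced topology), invariant under $\mathcal{S}_1$, and that $\mathcal{S}_2=\mathcal{S}_1|_{X_2}=\{S|_{X_2}\mid S\in\mathcal{S}_1\}$. If $\mathcal{K}(\mathcal{S}_1)$ and $\mathcal{K}(\mathcal{S}_2)$ are compact, then $$\mathcal{K}(\mathcal{S}_1)\to\mathcal{K}(\mathcal{S}_2),\quad S\mapsto S|_{X_2}$$ is a (well-defined) epimorphism of right topological semigroups. (ii) Assume that $\Phi\in\mathscr{L}(X_1,X_2)$ is surjective and $\Psi\colon\mathcal{S}_1\to\mathcal{S}_2$ is an epimorphism (surjective homomorphism) of semigroups with $\Phi(Sx)=\Psi(S)\Phi(x)$ for all $S\in\mathcal{S}_1$ and $x\in X_1$. If $\mathcal{K}(\mathcal{S}_1)$ is compact, then $$\hat\Psi\colon\mathcal{K}(\mathcal{S}_1)\to\mathcal{K}(\mathcal{S}_2),\quad S\mapsto\hat\Psi(S),$$ with $\hat\Psi(S)(\Phi(x)):=\Phi(Sx)$ for $S\in\mathcal{K}(\mathcal{S}_1)$ and $x\in X_1$, is a (well-defined) epimorphism of right topological semigroups with $\hat\Psi|_{\mathcal{S}_1}=\Psi$.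
   Context: All vector spaces are complex; topological vector spaces and compact spaces are Hausdorff. $\mathscr{L}(X,Y)$ is the set of continuous linear mappings $X\to Y$ and $\mathscr{L}(X)=\mathscr{L}(X,X)$. An operator semigroup on $X$ is a subsemigroup $\mathcal{S}\subset\mathscr{L}(X)$ (under composition). Its (abstract) Köhler semigroup is the closure $\mathcal{K}(\mathcal{S})=\overline{\mathcal{S}}\subset X^X$, where $X^X$ carries the product topology; with composition and the subspace topology it is a right topological semigroup, i.e. $S\mapsto ST$ is continuous for each fixed $T$. A homomorphism of right topological semigroups is a continuous multiplicative map; an epimorphism is a surjective homomorphism. *)

theory Defs
  imports "HOL-Analysis.Analysis"
begin

text \<open>
  A topological vector space is given by a complex scalar multiplication \<open>sc\<close> on an abelian
  group type together with an abstract topology \<open>X\<close>, whose underlying set \<open>topspace X\<close>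
  is a linear subspace of the type. Thus a vector space and its subspaces (with the induced topology
  \<open>subtopology X V\<close>) are objects of the same kind. Mappings defined on \<open>topspace X\<close>
  are represented by functions that are extensional there, so that equality of functions is equality
  of mappings, composition is \<^const>\<open>compose\<close> and restriction is \<^const>\<open>restrict\<close>.
\<close>

definition convex_wrt :: "(complex \<Rightarrow> 'a::ab_group_add \<Rightarrow> 'a) \<Rightarrow> 'a set \<Rightarrow> bool" where
  "convex_wrt sc C \<longleftrightarrow>
     (\<forall>x\<in>C. \<forall>y\<in>C. \<forall>u v :: real. 0 \<le> u \<longrightarrow> 0 \<le> v \<longrightarrow> u + v = 1 \<longrightarrow>
        sc (complex_of_real u) x + sc (complex_of_real v) y \<in> C)"

definition topological_vector_space ::
    "(complex \<Rightarrow> 'a::ab_group_add \<Rightarrow> 'a) \<Rightarrow> 'a topology \<Rightarrow> bool" where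
  "topological_vector_space sc X \<longleftrightarrow>
     vector_space sc \<and> module.subspace sc (topspace X) \<and> Hausdorff_space X \<and>
     continuous_map (prod_topology X X) X (\<lambda>(x, y). x + y) \<and>
     continuous_map (prod_topology euclidean X) X (\<lambda>(c, x). sc c x)"

definition locally_convex_space ::
    "(complex \<Rightarrow> 'a::ab_group_add \<Rightarrow> 'a) \<Rightarrow> 'a topology \<Rightarrow> bool" where
  "locally_convex_space sc X \<longleftrightarrow>
     topological_vector_space sc X \<and> neighbourhood_base_at 0 (convex_wrt sc) X"

definition continuous_linear_maps ::
    "(complex \<Rightarrow> 'a::ab_group_add \<Rightarrow> 'a) \<Rightarrow> 'a topology \<Rightarrow>
     (complex \<Rightarrow> 'b::ab_group_add \<Rightarrow> 'b) \<Rightarrow> 'b topology \<Rightarrow> ('a \<Rightarrow> 'b) set" where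
  "continuous_linear_maps sc1 X1 sc2 X2 =
     {f \<in> extensional (topspace X1).
        continuous_map X1 X2 f \<and>
        (\<forall>x\<in>topspace X1. \<forall>y\<in>topspace X1. f (x + y) = f x + f y) \<and>
        (\<forall>c. \<forall>x\<in>topspace X1. f (sc1 c x) = sc2 c (f x))}"

definition operator_semigroup ::
    "(complex \<Rightarrow> 'a::ab_group_add \<Rightarrow> 'a) \<Rightarrow> 'a topology \<Rightarrow> ('a \<Rightarrow> 'a) set \<Rightarrow> bool" where
  "operator_semigroup sc X \<S> \<longleftrightarrow>
     \<S> \<subseteq> continuous_linear_maps sc X sc X \<and>
     (\<forall>S\<in>\<S>. \<forall>T\<in>\<S>. compose (topspace X) S T \<in> \<S>)"

definition power_topology :: "'a topology \<Rightarrow> ('a \<Rightarrow> 'a) topology" where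
  "power_topology X = product_topology (\<lambda>_. X) (topspace X)"

definition koehler :: "'a topology \<Rightarrow> ('a \<Rightarrow> 'a) set \<Rightarrow> ('a \<Rightarrow> 'a) topology" where
  "koehler X \<S> = subtopology (power_topology X) (power_topology X closure_of \<S>)"

definition right_topological_semigroup :: "'s topology \<Rightarrow> ('s \<Rightarrow> 's \<Rightarrow> 's) \<Rightarrow> bool" where
  "right_topological_semigroup G m \<longleftrightarrow>
     (\<forall>s\<in>topspace G. \<forall>t\<in>topspace G. m s t \<in> topspace G) \<and>
     (\<forall>r\<in>topspace G. \<forall>s\<in>topspace G. \<forall>t\<in>topspace G. m (m r s) t = m r (m s t)) \<and>
     (\<forall>t\<in>topspace G. continuous_map G G (\<lambda>s. m s t))"

definition semigroup_hom ::
    "'s set \<Rightarrow> ('s \<Rightarrow> 's \<Rightarrow> 's) \<Rightarrow> 't set \<Rightarrow> ('t \<Rightarrow> 't \<Rightarrow> 't) \<Rightarrow> ('s \<Rightarrow> 't) \<Rightarrow> bool" where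
  "semigroup_hom A m B n h \<longleftrightarrow>
     h \<in> A \<rightarrow> B \<and> (\<forall>s\<in>A. \<forall>t\<in>A. h (m s t) = n (h s) (h t))"

definition semigroup_epi ::
    "'s set \<Rightarrow> ('s \<Rightarrow> 's \<Rightarrow> 's) \<Rightarrow> 't set \<Rightarrow> ('t \<Rightarrow> 't \<Rightarrow> 't) \<Rightarrow> ('s \<Rightarrow> 't) \<Rightarrow> bool" where
  "semigroup_epi A m B n h \<longleftrightarrow> semigroup_hom A m B n h \<and> h ` A = B"

definition right_topological_epi ::
    "'s topology \<Rightarrow> ('s \<Rightarrow> 's \<Rightarrow> 's) \<Rightarrow> 't topology \<Rightarrow> ('t \<Rightarrow> 't \<Rightarrow> 't) \<Rightarrow> ('s \<Rightarrow> 't) \<Rightarrow> bool" where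
  "right_topological_epi G m H n h \<longleftrightarrow>
     right_topological_semigroup G m \<and> right_topological_semigroup H n \<and>
     continuous_map G H h \<and> semigroup_epi (topspace G) m (topspace H) n h"

text \<open>
  The mapping \<open>T\<close> on \<open>X2\<close> with \<open>T (\<Phi> x) = \<Phi> (S x)\<close>. It is
  meaningful only if exactly one such mapping exists.
\<close>

definition factors_through ::
    "'a topology \<Rightarrow> 'b topology \<Rightarrow> ('a \<Rightarrow> 'b) \<Rightarrow> ('a \<Rightarrow> 'a) \<Rightarrow> ('b \<Rightarrow> 'b) \<Rightarrow> bool" where
  "factors_through X1 X2 \<Phi> S T \<longleftrightarrow>
     T \<in> topspace X2 \<rightarrow>\<^sub>E topspace X2 \<and> (\<forall>x\<in>topspace X1. T (\<Phi> x) = \<Phi> (S x))"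

definition induced_map ::
    "'a topology \<Rightarrow> 'b topology \<Rightarrow> ('a \<Rightarrow> 'b) \<Rightarrow> ('a \<Rightarrow> 'a) \<Rightarrow> ('b \<Rightarrow> 'b)" where
  "induced_map X1 X2 \<Phi> S = (THE T. factors_through X1 X2 \<Phi> S T)"

end

theory Submission
  imports Defs
begin

text \<open>
  Both parts rest on one fact: a continuous mapping from a compact space to a Hausdorff space
  carries a dense set \<open>D\<close> to a dense subset of its image, and the image is compact, hence closed;
  so the image is exactly the closure of the image of \<open>D\<close>
  (\<open>image_compact_space_eq_closure_of_dense\<close>). In a Koehler semigroup the operators themselves are
  dense, so a continuous extension of a surjection between the operator semigroups cannot miss
  a limit.

  For the restriction to \<open>V\<close>, the difficulty is that \<open>V\<close> need not be closed, so a pointwise limit of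
  operators leaving \<open>V\<close> invariant could, a priori, map points of \<open>V\<close> outside \<open>V\<close>. Restriction is
  therefore regarded first as a mapping into the space of all mappings from \<open>V\<close> to \<open>X1\<close>. Its image is
  the closure of \<open>\<S>2\<close> there. The Koehler semigroup of \<open>\<S>2\<close> is the trace of that closure on the
  self-mappings of \<open>V\<close>; as it is compact, it is closed in the larger space, and so it is the whole
  closure (\<open>closure_of_subset_if_compact_trace\<close>).

  For the factor, equality \<open>\<Phi> (S x) = \<Phi> (S y)\<close> is a closed condition on \<open>S\<close>. It holds for the
  operators of the semigroup whenever \<open>\<Phi> x = \<Phi> y\<close>, hence on the whole Koehler semigroup. As \<open>\<Phi>\<close> is
  onto, each \<open>S\<close> then induces exactly one mapping, and its value at a point is \<open>\<Phi> (S x)\<close> for any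
  fixed preimage \<open>x\<close>, which is continuous in \<open>S\<close>.

  That the closure is a semigroup at all is due to the continuity of the operators
  (\<open>compose_mem_closure\<close>).
\<close>

section \<open>Compact images and traces of closures\<close>

lemma image_compact_space_eq_closure_of_dense:
  assumes "compact_space K" "Hausdorff_space Y" "continuous_map K Y h"
    and D: "D \<subseteq> topspace K" and dense: "K closure_of D = topspace K"
  shows "h ` topspace K = Y closure_of (h ` D)"
proof
  show "h ` topspace K \<subseteq> Y closure_of (h ` D)"
    using continuous_map_image_closure_subset[OF assms(3), of D] dense by simp
  have "compactin Y (h ` topspace K)"
    using assms(1,3) by (simp add: compact_space_def image_compactin)
  then have "closedin Y (h ` topspace K)"
    by (rule compactin_imp_closedin[OF assms(2)])
  then show "Y closure_of (h ` D) \<subseteq> h ` topspace K"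
    by (intro closure_of_minimal image_mono D)
qed

text \<open>
  A compact trace \<open>W \<inter> Y closure_of D\<close> is a closed set containing \<open>D\<close>, so the closure has no points
  outside \<open>W\<close>, even when \<open>W\<close> itself is not closed.
\<close>

lemma closure_of_subset_if_compact_trace:
  assumes "Hausdorff_space Y" "D \<subseteq> topspace Y" "D \<subseteq> W"
    and "compactin Y (W \<inter> Y closure_of D)"
  shows "Y closure_of D \<subseteq> W"
proof -
  have "closedin Y (W \<inter> Y closure_of D)"
    using assms(1,4) by (rule compactin_imp_closedin)
  moreover have "D \<subseteq> W \<inter> Y closure_of D"
    using assms(2,3) by (simp add: closure_of_subset)
  ultimately have "Y closure_of D \<subseteq> W \<inter> Y closure_of D"
    by (rule closure_of_minimal[rotated])
  then show ?thesis
    by simp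
qed

section \<open>The closure of an operator semigroup\<close>

lemma topspace_power_topology: "topspace (power_topology X) = topspace X \<rightarrow>\<^sub>E topspace X"
  by (simp add: power_topology_def)

lemma Hausdorff_power_topology:
  "Hausdorff_space X \<Longrightarrow> Hausdorff_space (power_topology X)"
  by (simp add: power_topology_def Hausdorff_space_product_topology)

lemma topspace_koehler: "topspace (koehler X \<S>) = power_topology X closure_of \<S>"
  using closure_of_subset_topspace[of "power_topology X" \<S>]
  by (auto simp: koehler_def)

lemma koehler_subset_maps: "topspace (koehler X \<S>) \<subseteq> topspace X \<rightarrow>\<^sub>E topspace X"
  using closure_of_subset_topspace[of "power_topology X" \<S>]
  by (simp add: topspace_koehler topspace_power_topology)

lemma koehler_maps_into: "S \<in> topspace (koehler X \<S>) \<Longrightarrow> x \<in> topspace X \<Longrightarrow> S x \<in> topspace X"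
  using koehler_subset_maps by blast

lemma continuous_map_koehler_power:
  "continuous_map (power_topology X) Y h \<Longrightarrow> continuous_map (koehler X \<S>) Y h"
  by (simp add: koehler_def continuous_map_from_subtopology)

lemma operator_semigroup_subset_maps:
  assumes "operator_semigroup sc X \<S>"
  shows "\<S> \<subseteq> topspace X \<rightarrow>\<^sub>E topspace X"
proof
  fix S assume "S \<in> \<S>"
  then have "S \<in> extensional (topspace X)" "continuous_map X X S"
    using assms by (auto simp: operator_semigroup_def continuous_linear_maps_def)
  then show "S \<in> topspace X \<rightarrow>\<^sub>E topspace X"
    using continuous_map_funspace[of X X S] by (simp add: PiE_def)
qed

lemma operator_semigroup_subset_koehler:
  assumes "operator_semigroup sc X \<S>"
  shows "\<S> \<subseteq> topspace (koehler X \<S>)"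
  using operator_semigroup_subset_maps[OF assms]
  by (simp add: topspace_koehler closure_of_subset topspace_power_topology)

lemma dense_in_koehler:
  assumes "operator_semigroup sc X \<S>"
  shows "koehler X \<S> closure_of \<S> = topspace (koehler X \<S>)"
  using operator_semigroup_subset_koehler[OF assms]
  by (simp add: koehler_def closure_of_subtopology topspace_koehler Int_absorb1 closure_of_subset_topspace)

lemma continuous_map_evaluation:
  "x \<in> topspace X \<Longrightarrow> continuous_map (power_topology X) X (\<lambda>S. S x)"
  unfolding power_topology_def by (rule continuous_map_product_projection)

lemma continuous_map_into_power_topology:
  assumes "\<And>s. s \<in> topspace Z \<Longrightarrow> h s \<in> extensional (topspace X)"
    and "\<And>x. x \<in> topspace X \<Longrightarrow> continuous_map Z X (\<lambda>s. h s x)"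
  shows "continuous_map Z (power_topology X) h"
  using assms by (auto simp: power_topology_def continuous_map_componentwise)

lemma continuous_map_right_translation:
  assumes T: "T \<in> topspace X \<rightarrow> topspace X"
  shows "continuous_map (power_topology X) (power_topology X) (\<lambda>S. compose (topspace X) S T)"
proof (rule continuous_map_into_power_topology)
  show "continuous_map (power_topology X) X (\<lambda>S. compose (topspace X) S T x)"
    if "x \<in> topspace X" for x
    using that T continuous_map_evaluation[of "T x" X] by (auto simp: compose_def)
qed (simp add: compose_def)

lemma continuous_map_left_translation:
  assumes T: "continuous_map X X T"
  shows "continuous_map (power_topology X) (power_topology X) (compose (topspace X) T)"
proof (rule continuous_map_into_power_topology)
  show "continuous_map (power_topology X) X (\<lambda>S. compose (topspace X) T S x)"
    if "x \<in> topspace X" for x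
    using that continuous_map_compose[OF continuous_map_evaluation[OF that] T]
    by (simp add: compose_def o_def)
qed (simp add: compose_def)

text \<open>
  Right translations are continuous for every right factor, left translations by continuous left
  factors. So the closure is entered in two steps: first with an operator as left factor, letting
  the right factor run through the closure, and then with that right factor fixed.
\<close>

lemma compose_mem_closure:
  assumes sg: "operator_semigroup sc X \<S>"
    and S: "S \<in> topspace (koehler X \<S>)" and T: "T \<in> topspace (koehler X \<S>)"
  shows "compose (topspace X) S T \<in> topspace (koehler X \<S>)"
proof -
  let ?P = "power_topology X" and ?K = "power_topology X closure_of \<S>"
  have step: "compose (topspace X) R T \<in> ?K" if R: "R \<in> \<S>" for R
  proof -
    have "continuous_map X X R"
      using sg R by (auto simp: operator_semigroup_def continuous_linear_maps_def)
    from continuous_map_image_closure_subset[OF continuous_map_left_translation[OF this], of \<S>]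
    have "compose (topspace X) R ` ?K \<subseteq> ?P closure_of (compose (topspace X) R ` \<S>)" .
    also have "\<dots> \<subseteq> ?K"
      using sg R by (intro closure_of_mono) (auto simp: operator_semigroup_def)
    finally show ?thesis
      using T by (auto simp: topspace_koehler)
  qed
  have "T \<in> topspace X \<rightarrow> topspace X"
    using T koehler_subset_maps by blast
  from continuous_map_image_closure_subset[OF continuous_map_right_translation[OF this], of \<S>]
  have "(\<lambda>R. compose (topspace X) R T) ` ?K
      \<subseteq> ?P closure_of ((\<lambda>R. compose (topspace X) R T) ` \<S>)" .
  also have "\<dots> \<subseteq> ?K"
    using step by (intro closure_of_minimal) auto
  finally show ?thesis
    using S by (auto simp: topspace_koehler)
qed

lemma right_topological_semigroup_koehler:
  assumes sg: "operator_semigroup sc X \<S>"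
  shows "right_topological_semigroup (koehler X \<S>) (compose (topspace X))"
  unfolding right_topological_semigroup_def
proof (intro conjI ballI)
  fix S T assume "S \<in> topspace (koehler X \<S>)" "T \<in> topspace (koehler X \<S>)"
  then show "compose (topspace X) S T \<in> topspace (koehler X \<S>)"
    by (rule compose_mem_closure[OF sg])
next
  fix R S T assume "T \<in> topspace (koehler X \<S>)"
  then have "T \<in> topspace X \<rightarrow> topspace X"
    using koehler_subset_maps by blast
  then show "compose (topspace X) (compose (topspace X) R S) T
      = compose (topspace X) R (compose (topspace X) S T)"
    by (auto simp: compose_def fun_eq_iff)
next
  fix T assume T: "T \<in> topspace (koehler X \<S>)"
  then have "T \<in> topspace X \<rightarrow> topspace X"
    using koehler_subset_maps by blast
  note continuous_map_koehler_power[OF continuous_map_right_translation[OF this], of \<S>]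
  moreover have "compose (topspace X) S T \<in> power_topology X closure_of \<S>"
    if "S \<in> topspace (koehler X \<S>)" for S
    using compose_mem_closure[OF sg that T] by (simp add: topspace_koehler)
  ultimately show "continuous_map (koehler X \<S>) (koehler X \<S>) (\<lambda>S. compose (topspace X) S T)"
    by (subst (2) koehler_def) (auto simp: continuous_map_in_subtopology)
qed

lemma right_topological_epi_koehlerI:
  assumes sg1: "operator_semigroup sc1 X1 \<S>1" and sg2: "operator_semigroup sc2 X2 \<S>2"
    and cont: "continuous_map (koehler X1 \<S>1) (power_topology X2) h"
    and image: "h ` topspace (koehler X1 \<S>1) = topspace (koehler X2 \<S>2)"
    and mult: "\<And>S T. S \<in> topspace (koehler X1 \<S>1) \<Longrightarrow> T \<in> topspace (koehler X1 \<S>1) \<Longrightarrow>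
      h (compose (topspace X1) S T) = compose (topspace X2) (h S) (h T)"
  shows "right_topological_epi (koehler X1 \<S>1) (compose (topspace X1))
    (koehler X2 \<S>2) (compose (topspace X2)) h"
proof -
  have "continuous_map (koehler X1 \<S>1) (koehler X2 \<S>2) h"
    using cont image
    by (subst (2) koehler_def) (auto simp: continuous_map_in_subtopology topspace_koehler)
  then show ?thesis
    using right_topological_semigroup_koehler[OF sg1] right_topological_semigroup_koehler[OF sg2]
      image mult
    by (auto simp: right_topological_epi_def semigroup_epi_def semigroup_hom_def)
qed

section \<open>Restriction to an invariant subspace\<close>

lemma power_topology_subtopology:
  assumes "V \<subseteq> topspace X"
  shows "power_topology (subtopology X V)
    = subtopology (product_topology (\<lambda>_. X) V) (V \<rightarrow>\<^sub>E V)"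
  using assms
  by (simp add: power_topology_def subtopology_product_topology Int_absorb1)

lemma koehler_restriction:
  assumes Haus: "Hausdorff_space X"
    and sg1: "operator_semigroup sc X \<S>1"
    and sg2: "operator_semigroup sc (subtopology X V) \<S>2"
    and V: "V \<subseteq> topspace X" and \<S>2: "\<S>2 = (\<lambda>S. restrict S V) ` \<S>1"
    and K1: "compact_space (koehler X \<S>1)"
    and K2: "compact_space (koehler (subtopology X V) \<S>2)"
  shows "right_topological_epi (koehler X \<S>1) (compose (topspace X))
    (koehler (subtopology X V) \<S>2) (compose (topspace (subtopology X V))) (\<lambda>S. restrict S V)"
proof -
  let ?X2 = "subtopology X V" and ?r = "\<lambda>S. restrict S V"
  let ?Q = "product_topology (\<lambda>_. X) V"
  have top2: "topspace ?X2 = V"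
    using V by auto
  have pow2: "power_topology ?X2 = subtopology ?Q (V \<rightarrow>\<^sub>E V)"
    by (rule power_topology_subtopology[OF V])
  have \<S>2V: "\<S>2 \<subseteq> V \<rightarrow>\<^sub>E V"
    using operator_semigroup_subset_maps[OF sg2] by (simp only: top2)
  have \<S>2Q: "\<S>2 \<subseteq> topspace ?Q"
    using \<S>2V V by auto
  have HQ: "Hausdorff_space ?Q"
    using Haus by (simp add: Hausdorff_space_product_topology)
  have K2_eq: "topspace (koehler ?X2 \<S>2) = (V \<rightarrow>\<^sub>E V) \<inter> ?Q closure_of \<S>2"
    using \<S>2V by (simp add: topspace_koehler pow2 closure_of_subtopology Int_absorb1)
  have "compactin (power_topology ?X2) (topspace (koehler ?X2 \<S>2))"
    using K2 by (metis koehler_def compact_space_subtopology compactin_subspace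
      closure_of_subset_topspace topspace_koehler)
  then have "compactin ?Q ((V \<rightarrow>\<^sub>E V) \<inter> ?Q closure_of \<S>2)"
    by (simp add: pow2 K2_eq compactin_subtopology)
  then have trace: "?Q closure_of \<S>2 \<subseteq> V \<rightarrow>\<^sub>E V"
    by (rule closure_of_subset_if_compact_trace[OF HQ \<S>2Q \<S>2V])
  have contQ: "continuous_map (koehler X \<S>1) ?Q ?r"
    using V by (intro continuous_map_koehler_power)
      (auto simp: continuous_map_componentwise intro: continuous_map_evaluation)
  have image: "?r ` topspace (koehler X \<S>1) = topspace (koehler ?X2 \<S>2)"
    using image_compact_space_eq_closure_of_dense[OF K1 HQ contQ
        operator_semigroup_subset_koehler[OF sg1] dense_in_koehler[OF sg1]] trace
    by (simp add: K2_eq Int_absorb1 flip: \<S>2)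
  \<comment> \<open>Invariance of \<open>V\<close> passes to limits only because the image has been identified first.\<close>
  have invariant: "T x \<in> V" if "T \<in> topspace (koehler X \<S>1)" "x \<in> V" for T x
  proof -
    have "?r T \<in> V \<rightarrow>\<^sub>E V"
      using that(1) image K2_eq by blast
    with \<open>x \<in> V\<close> show ?thesis
      by (auto dest: PiE_mem)
  qed
  show ?thesis
  proof (rule right_topological_epi_koehlerI[OF sg1 sg2 _ image])
    show "continuous_map (koehler X \<S>1) (power_topology ?X2) ?r"
      using contQ invariant by (auto simp: pow2 continuous_map_in_subtopology)
  next
    fix S T assume "S \<in> topspace (koehler X \<S>1)" and T: "T \<in> topspace (koehler X \<S>1)"
    show "?r (compose (topspace X) S T) = compose (topspace ?X2) (?r S) (?r T)"
      unfolding top2 using invariant[OF T] V by (auto simp: compose_def fun_eq_iff restrict_def)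
  qed
qed

section \<open>Passage to a factor\<close>

lemma factors_through_unique:
  assumes onto: "\<Phi> ` topspace X1 = topspace X2"
    and "factors_through X1 X2 \<Phi> S T" "factors_through X1 X2 \<Phi> S T'"
  shows "T = T'"
proof (rule PiE_ext)
  show "T \<in> topspace X2 \<rightarrow>\<^sub>E topspace X2" "T' \<in> topspace X2 \<rightarrow>\<^sub>E topspace X2"
    using assms(2,3) by (simp_all add: factors_through_def)
  show "T y = T' y" if "y \<in> topspace X2" for y
  proof -
    from that onto obtain x where "x \<in> topspace X1" "y = \<Phi> x"
      by blast
    then show ?thesis
      using assms(2,3) by (simp add: factors_through_def)
  qed
qed

lemma induced_map_eqI:
  assumes "\<Phi> ` topspace X1 = topspace X2" "factors_through X1 X2 \<Phi> S T"
  shows "induced_map X1 X2 \<Phi> S = T"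
  unfolding induced_map_def using assms factors_through_unique by (metis the_equality)

lemma factors_through_compose:
  assumes S: "factors_through X1 X2 \<Phi> S S'" and T: "factors_through X1 X2 \<Phi> T T'"
    and T_into: "\<And>x. x \<in> topspace X1 \<Longrightarrow> T x \<in> topspace X1"
    and \<Phi>: "\<Phi> ` topspace X1 \<subseteq> topspace X2"
  shows "factors_through X1 X2 \<Phi> (compose (topspace X1) S T) (compose (topspace X2) S' T')"
  unfolding factors_through_def
proof (intro conjI ballI)
  show "compose (topspace X2) S' T' \<in> topspace X2 \<rightarrow>\<^sub>E topspace X2"
    using S T by (auto simp: factors_through_def compose_def)
  fix x assume x: "x \<in> topspace X1"
  then have "\<Phi> x \<in> topspace X2"
    using \<Phi> by blast
  then show "compose (topspace X2) S' T' (\<Phi> x) = \<Phi> (compose (topspace X1) S T x)"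
    using S T T_into x by (simp add: factors_through_def compose_def)
qed

text \<open>
  The \<open>S\<close> with \<open>\<Phi> (S x) = \<Phi> (S y)\<close> form a closed set, the equalizer of two continuous mappings
  into a Hausdorff space; applied to points of one fibre of \<open>\<Phi>\<close>, this makes induced mappings
  well-defined.
\<close>

lemma koehler_respects_fibres:
  assumes Haus: "Hausdorff_space X2" and \<Phi>: "continuous_map X1 X2 \<Phi>"
    and ops: "\<And>S. S \<in> \<S> \<Longrightarrow> \<Phi> (S x) = \<Phi> (S y)"
    and S: "S \<in> topspace (koehler X1 \<S>)"
    and xy: "x \<in> topspace X1" "y \<in> topspace X1"
  shows "\<Phi> (S x) = \<Phi> (S y)"
proof -
  have cont: "continuous_map (power_topology X1) X2 (\<lambda>S. \<Phi> (S z))" if "z \<in> topspace X1" for z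
    using continuous_map_compose[OF continuous_map_evaluation[OF that] \<Phi>] by (simp add: o_def)
  have "S \<in> power_topology X1 closure_of \<S>"
    using S by (simp add: topspace_koehler)
  from forall_in_closure_of_eq[OF this Haus cont[OF xy(1)] cont[OF xy(2)] ops]
  show ?thesis .
qed

text \<open>
  Fixing one preimage \<open>lift y\<close> for each \<open>y\<close> turns the induced mapping into an explicit formula, from
  which its continuity in \<open>S\<close> can be read off. Multiplicativity needs no formula: both sides factor the
  same product, and factors are unique.
\<close>

lemma koehler_factor:
  assumes Haus: "Hausdorff_space X2"
    and sg1: "operator_semigroup sc1 X1 \<S>1" and sg2: "operator_semigroup sc2 X2 \<S>2"
    and \<Phi>: "continuous_map X1 X2 \<Phi>" and onto: "\<Phi> ` topspace X1 = topspace X2"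
    and \<Psi>: "\<Psi> ` \<S>1 = \<S>2"
    and intertwines: "\<And>S x. S \<in> \<S>1 \<Longrightarrow> x \<in> topspace X1 \<Longrightarrow> \<Phi> (S x) = \<Psi> S (\<Phi> x)"
    and K1: "compact_space (koehler X1 \<S>1)"
  shows "\<forall>S\<in>topspace (koehler X1 \<S>1). \<exists>!T. factors_through X1 X2 \<Phi> S T"
    and "right_topological_epi (koehler X1 \<S>1) (compose (topspace X1))
      (koehler X2 \<S>2) (compose (topspace X2)) (induced_map X1 X2 \<Phi>)"
    and "\<forall>S\<in>\<S>1. induced_map X1 X2 \<Phi> S = \<Psi> S"
proof -
  let ?K = "topspace (koehler X1 \<S>1)" and ?h = "induced_map X1 X2 \<Phi>"
  define lift where "lift = inv_into (topspace X1) \<Phi>"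
  have lift: "lift y \<in> topspace X1" "\<Phi> (lift y) = y" if "y \<in> topspace X2" for y
    using that onto by (auto simp: lift_def inv_into_into f_inv_into_f)
  have \<Phi>_into: "\<Phi> x \<in> topspace X2" if "x \<in> topspace X1" for x
    using that onto by blast
  have factor: "factors_through X1 X2 \<Phi> S (\<lambda>y\<in>topspace X2. \<Phi> (S (lift y)))" if S: "S \<in> ?K" for S
  proof -
    have "\<Phi> (S (lift (\<Phi> x))) = \<Phi> (S x)" if x: "x \<in> topspace X1" for x
      using x by (intro koehler_respects_fibres[OF Haus \<Phi> _ S])
        (simp_all add: intertwines lift \<Phi>_into)
    then show ?thesis
      using S by (auto simp: factors_through_def \<Phi>_into lift koehler_maps_into)
  qed
  show "\<forall>S\<in>?K. \<exists>!T. factors_through X1 X2 \<Phi> S T"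
    using factor factors_through_unique[OF onto] by metis
  have h: "?h S = (\<lambda>y\<in>topspace X2. \<Phi> (S (lift y)))" if "S \<in> ?K" for S
    by (rule induced_map_eqI[OF onto factor[OF that]])
  have h_factors: "factors_through X1 X2 \<Phi> S (?h S)" if "S \<in> ?K" for S
    using factor[OF that] by (simp add: h[OF that])
  show extends: "\<forall>S\<in>\<S>1. ?h S = \<Psi> S"
  proof
    fix S assume S: "S \<in> \<S>1"
    have "\<Psi> S \<in> topspace X2 \<rightarrow>\<^sub>E topspace X2"
      using S \<Psi> operator_semigroup_subset_maps[OF sg2] by blast
    then show "?h S = \<Psi> S"
      using S intertwines by (intro induced_map_eqI[OF onto]) (simp add: factors_through_def)
  qed
  have "continuous_map (koehler X1 \<S>1) X2 (\<lambda>S. \<Phi> (S (lift y)))" if "y \<in> topspace X2" for y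
    using continuous_map_koehler_power[OF continuous_map_compose[OF
          continuous_map_evaluation[OF lift(1)[OF that]] \<Phi>]] by (simp add: o_def)
  then have "continuous_map (koehler X1 \<S>1) (power_topology X2)
      (\<lambda>S. \<lambda>y\<in>topspace X2. \<Phi> (S (lift y)))"
    by (intro continuous_map_into_power_topology) simp_all
  then have cont: "continuous_map (koehler X1 \<S>1) (power_topology X2) ?h"
    by (rule continuous_map_eq) (simp add: h)
  have "?h ` \<S>1 = \<S>2"
    using extends \<Psi> by (metis image_cong)
  then have image: "?h ` ?K = topspace (koehler X2 \<S>2)"
    using image_compact_space_eq_closure_of_dense[OF K1 Hausdorff_power_topology[OF Haus] cont
        operator_semigroup_subset_koehler[OF sg1] dense_in_koehler[OF sg1]]
    by (simp add: topspace_koehler)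
  show "right_topological_epi (koehler X1 \<S>1) (compose (topspace X1))
      (koehler X2 \<S>2) (compose (topspace X2)) ?h"
  proof (rule right_topological_epi_koehlerI[OF sg1 sg2 cont image])
    fix S T assume S: "S \<in> ?K" and T: "T \<in> ?K"
    show "?h (compose (topspace X1) S T) = compose (topspace X2) (?h S) (?h T)"
      using onto by (intro induced_map_eqI[OF onto]
          factors_through_compose[OF h_factors[OF S] h_factors[OF T]])
        (auto intro: koehler_maps_into[OF T])
  qed
qed

section \<open>The two epimorphisms\<close>

theorem proposition2p5:
  fixes sc1 :: "complex \<Rightarrow> 'a::ab_group_add \<Rightarrow> 'a"
    and X1 :: "'a topology"
    and \<S>1 :: "('a \<Rightarrow> 'a) set"
  assumes "locally_convex_space sc1 X1"
    and "operator_semigroup sc1 X1 \<S>1"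
  shows
    "(\<forall>(X2 :: 'a topology) (\<S>2 :: ('a \<Rightarrow> 'a) set) (V :: 'a set).
        locally_convex_space sc1 X2 \<longrightarrow>
        operator_semigroup sc1 X2 \<S>2 \<longrightarrow>
        module.subspace sc1 V \<longrightarrow> V \<subseteq> topspace X1 \<longrightarrow> X2 = subtopology X1 V \<longrightarrow>
        (\<forall>S\<in>\<S>1. S ` V \<subseteq> V) \<longrightarrow>
        \<S>2 = (\<lambda>S. restrict S V) ` \<S>1 \<longrightarrow>
        compact_space (koehler X1 \<S>1) \<longrightarrow>
        compact_space (koehler X2 \<S>2) \<longrightarrow>
        right_topological_epi
          (koehler X1 \<S>1) (compose (topspace X1))
          (koehler X2 \<S>2) (compose (topspace X2))
          (\<lambda>S. restrict S V))
     \<and>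
     (\<forall>(sc2 :: complex \<Rightarrow> 'b::ab_group_add \<Rightarrow> 'b) (X2 :: 'b topology) (\<S>2 :: ('b \<Rightarrow> 'b) set)
        (\<Phi> :: 'a \<Rightarrow> 'b) (\<Psi> :: ('a \<Rightarrow> 'a) \<Rightarrow> ('b \<Rightarrow> 'b)).
        locally_convex_space sc2 X2 \<longrightarrow>
        operator_semigroup sc2 X2 \<S>2 \<longrightarrow>
        \<Phi> \<in> continuous_linear_maps sc1 X1 sc2 X2 \<longrightarrow>
        \<Phi> ` topspace X1 = topspace X2 \<longrightarrow>
        semigroup_epi \<S>1 (compose (topspace X1)) \<S>2 (compose (topspace X2)) \<Psi> \<longrightarrow>
        (\<forall>S\<in>\<S>1. \<forall>x\<in>topspace X1. \<Phi> (S x) = \<Psi> S (\<Phi> x)) \<longrightarrow>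
        compact_space (koehler X1 \<S>1) \<longrightarrow>
        (\<forall>S\<in>topspace (koehler X1 \<S>1). \<exists>!T. factors_through X1 X2 \<Phi> S T) \<and>
        right_topological_epi
          (koehler X1 \<S>1) (compose (topspace X1))
          (koehler X2 \<S>2) (compose (topspace X2))
          (induced_map X1 X2 \<Phi>) \<and>
        (\<forall>S\<in>\<S>1. induced_map X1 X2 \<Phi> S = \<Psi> S))"
proof (rule conjI; intro allI impI)
  fix X2 :: "'a topology" and \<S>2 V
  assume "operator_semigroup sc1 X2 \<S>2" "V \<subseteq> topspace X1" "X2 = subtopology X1 V"
    "\<S>2 = (\<lambda>S. restrict S V) ` \<S>1"
    "compact_space (koehler X1 \<S>1)" "compact_space (koehler X2 \<S>2)"
  moreover have "Hausdorff_space X1"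
    using assms(1) by (simp add: locally_convex_space_def topological_vector_space_def)
  ultimately show "right_topological_epi (koehler X1 \<S>1) (compose (topspace X1))
      (koehler X2 \<S>2) (compose (topspace X2)) (\<lambda>S. restrict S V)"
    using koehler_restriction[of X1 sc1 \<S>1 V \<S>2] assms(2) by blast
next
  fix sc2 :: "complex \<Rightarrow> 'b \<Rightarrow> 'b" and X2 \<S>2 \<Phi> \<Psi>
  assume lcs2: "locally_convex_space sc2 X2" and sg2: "operator_semigroup sc2 X2 \<S>2"
    and "\<Phi> \<in> continuous_linear_maps sc1 X1 sc2 X2" and onto: "\<Phi> ` topspace X1 = topspace X2"
    and "semigroup_epi \<S>1 (compose (topspace X1)) \<S>2 (compose (topspace X2)) \<Psi>"
    and intertwines: "\<forall>S\<in>\<S>1. \<forall>x\<in>topspace X1. \<Phi> (S x) = \<Psi> S (\<Phi> x)"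
    and K1: "compact_space (koehler X1 \<S>1)"
  then have "Hausdorff_space X2" "continuous_map X1 X2 \<Phi>" "\<Psi> ` \<S>1 = \<S>2"
    by (simp_all add: locally_convex_space_def topological_vector_space_def
        continuous_linear_maps_def semigroup_epi_def)
  note factor = koehler_factor[OF this(1) assms(2) sg2 this(2) onto this(3) _ K1]
  show "(\<forall>S\<in>topspace (koehler X1 \<S>1). \<exists>!T. factors_through X1 X2 \<Phi> S T) \<and>
      right_topological_epi (koehler X1 \<S>1) (compose (topspace X1))
        (koehler X2 \<S>2) (compose (topspace X2)) (induced_map X1 X2 \<Phi>) \<and>
      (\<forall>S\<in>\<S>1. induced_map X1 X2 \<Phi> S = \<Psi> S)"
    using intertwines by (intro conjI factor) auto
qed

end
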